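(* Let $R$ be a hemiring. Then each fuzzy $h$-ideal of $R$ is idempotent if and only if the set of all fuzzy $h$-ideals of $R$, ordered by $\leq$, forms a distributive lattice under the $h$-sum $+_h$ (as join) and the $h$-intrinsic product $\odot_h$ (as meet) of fuzzy $h$-ideals, with $\lambda\odot_h\mu=\lambda\wedge\mu$ for all fuzzy $h$-ideals $\lambda,\mu$ of $R$.
   Context: A hemiring is a set $R$ with operations $+$ and $\cdot$ such that $(R,+)$ is a commutative semigroup, $(R,\cdot)$ is a semigroup, multiplication distributes over addition on both sides, and there is $0\in R$ with $a+0=0+a=a$ and $a0=0a=0$ for all $a\in R$. A fuzzy subset of $R$ is a map $\lambda:R\to[0,1]$. Write $\lambda\leq\mu$ if $\lambda(x)\leq\mu(x)$ for all $x\in R$; $\wedge$ denotes (pointwise) minimum. A fuzzy $h$-ideal of $R$ is a fuzzy subset $\lambda$ such that for all $a,b,x,y\in R$: $\lambda(a+b)\geq\lambda(a)\wedge\lambda(b)$; $\lambda(ab)\geq\lambda(a)$ and $\lambda(ab)\geq\lambda(b)$; and $x+a+y=b+y$ implies $\lambda(x)\geq\lambda(a)\wedge\lambda(b)$. The $h$-intrinsic product of fuzzy subsets $\mu,\nu$ is $(\mu\odot_h\nu)(x)=\sup\big(\bigwedge_{i=1}^m(\mu(a_i)\wedge\nu(b_i))\wedge\bigwedge_{j=1}^n(\mu(a_j')\wedge\nu(b_j'))\big)$, the supremum being over all expressions $x+\sum_{i=1}^m a_ib_i+z=\sum_{j=1}^n a_j'b_j'+z$ with $m,n\geq1$ and $a_i,b_i,a_j',b_j',z\in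 R$, and $(\mu\odot_h\nu)(x)=0$ if no such expression exists. A fuzzy $h$-ideal $\lambda$ is idempotent if $\lambda\odot_h\lambda=\lambda$. The $h$-sum of fuzzy subsets $\lambda,\mu$ is $(\lambda+_h\mu)(x)=\sup\big(\lambda(a_1)\wedge\lambda(a_2)\wedge\mu(b_1)\wedge\mu(b_2)\big)$, the supremum being over all $a_1,b_1,a_2,b_2,z\in R$ with $x+(a_1+b_1)+z=(a_2+b_2)+z$.
   Formalization: The claim that the h-sum is the join is made only for fuzzy h-ideals λ, μ with λ(0)=μ(0); without this it fails in every hemiring (the h-sum of the constants 1 and 0 is 0, their join is 1), though all fuzzy h-ideals of, e.g., the real numbers are idempotent. *)

theory Defs
  imports Complex_Main "HOL-Algebra.Lattice"
begin

text \<open>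
  Hemirings are the members of the type class \<open>semiring_0\<close>. Suprema of membership values are
  taken in the reals; all sets involved are subsets of the unit interval, and the empty set
  (for which \<open>Sup\<close> on the reals is unspecified) only occurs for the product, where it is
  treated separately.
\<close>

definition fuzzy_subset :: "('a \<Rightarrow> real) \<Rightarrow> bool" where
  "fuzzy_subset \<mu> \<longleftrightarrow> (\<forall>x. \<mu> x \<in> {0..1})"

definition fuzzy_h_ideal :: "('a::semiring_0 \<Rightarrow> real) \<Rightarrow> bool" where
  "fuzzy_h_ideal \<mu> \<longleftrightarrow> fuzzy_subset \<mu> \<and>
     (\<forall>a b. \<mu> (a + b) \<ge> min (\<mu> a) (\<mu> b)) \<and>
     (\<forall>a b. \<mu> (a * b) \<ge> \<mu> a) \<and>
     (\<forall>a b. \<mu> (a * b) \<ge> \<mu> b) \<and>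
     (\<forall>a b x y. x + a + y = b + y \<longrightarrow> \<mu> x \<ge> min (\<mu> a) (\<mu> b))"

definition h_product_values ::
  "('a::semiring_0 \<Rightarrow> real) \<Rightarrow> ('a \<Rightarrow> real) \<Rightarrow> 'a \<Rightarrow> real set" where
  "h_product_values \<mu> \<nu> x =
     {min (MIN i\<in>{1..m}. min (\<mu> (a i)) (\<nu> (b i)))
          (MIN j\<in>{1..n}. min (\<mu> (a' j)) (\<nu> (b' j))) | (m::nat) (n::nat) a b a' b' z.
        1 \<le> m \<and> 1 \<le> n \<and>
        x + (\<Sum>i = 1..m. a i * b i) + z = (\<Sum>j = 1..n. a' j * b' j) + z}"

definition h_product ::
  "('a::semiring_0 \<Rightarrow> real) \<Rightarrow> ('a \<Rightarrow> real) \<Rightarrow> 'a \<Rightarrow> real" (infixl \<open>\<odot>\<^sub>h\<close> 70) where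
  "(\<mu> \<odot>\<^sub>h \<nu>) x =
     (if h_product_values \<mu> \<nu> x = {} then 0 else Sup (h_product_values \<mu> \<nu> x))"

definition h_sum ::
  "('a::semiring_0 \<Rightarrow> real) \<Rightarrow> ('a \<Rightarrow> real) \<Rightarrow> 'a \<Rightarrow> real" (infixl \<open>+\<^sub>h\<close> 65) where
  "(\<mu> +\<^sub>h \<nu>) x =
     Sup {min (min (\<mu> a1) (\<mu> a2)) (min (\<nu> b1) (\<nu> b2)) | a1 b1 a2 b2 z.
            x + (a1 + b1) + z = (a2 + b2) + z}"

definition h_idempotent :: "('a::semiring_0 \<Rightarrow> real) \<Rightarrow> bool" where
  "h_idempotent \<mu> \<longleftrightarrow> \<mu> \<odot>\<^sub>h \<mu> = \<mu>"

definition fuzzy_h_ideals :: "('a::semiring_0 \<Rightarrow> real) gorder" where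
  "fuzzy_h_ideals = \<lparr>carrier = Collect fuzzy_h_ideal, eq = (=), le = (\<le>)\<rparr>"

definition distributive_lattice :: "('b, 'c) gorder_scheme \<Rightarrow> bool" where
  "distributive_lattice L \<longleftrightarrow> lattice L \<and>
     (\<forall>x\<in>carrier L. \<forall>y\<in>carrier L. \<forall>z\<in>carrier L.
        x \<sqinter>\<^bsub>L\<^esub> (y \<squnion>\<^bsub>L\<^esub> z) = (x \<sqinter>\<^bsub>L\<^esub> y) \<squnion>\<^bsub>L\<^esub> (x \<sqinter>\<^bsub>L\<^esub> z))"

text \<open>
  Every value of the \<open>h\<close>-sum is bounded by the values of both summands at \<open>0\<close>. Hence the
  \<open>h\<close>-sum of two fuzzy \<open>h\<close>-ideals can only be an upper bound of them, let alone their
  join, if they agree at \<open>0\<close>. For instance, the \<open>h\<close>-sum of the constants \<open>1\<close> and \<open>0\<close> is \<open>0\<close>.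
\<close>

lemma h_ideal_le_zero: "fuzzy_h_ideal \<mu> \<Longrightarrow> \<mu> x \<le> \<mu> 0"
  unfolding fuzzy_h_ideal_def by (metis mult_zero_right)

lemma h_sum_le:
  assumes "fuzzy_h_ideal \<mu>" "fuzzy_h_ideal \<nu>"
  shows "(\<mu> +\<^sub>h \<nu>) x \<le> min (\<mu> 0) (\<nu> 0)"
  unfolding h_sum_def
proof (rule cSup_least)
  have "x + (0 + 0) + 0 = (x + 0) + 0" by simp
  then show "{min (min (\<mu> a1) (\<mu> a2)) (min (\<nu> b1) (\<nu> b2)) | a1 b1 a2 b2 z.
            x + (a1 + b1) + z = (a2 + b2) + z} \<noteq> {}" by blast
qed (use assms[THEN h_ideal_le_zero] in \<open>auto simp: min_le_iff_disj\<close>)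

lemma h_sum_upper_bound_imp_eq_at_zero:
  assumes "fuzzy_h_ideal \<mu>" "fuzzy_h_ideal \<nu>" "\<mu> \<le> \<mu> +\<^sub>h \<nu>" "\<nu> \<le> \<mu> +\<^sub>h \<nu>"
  shows "\<mu> 0 = \<nu> 0"
  using h_sum_le[OF assms(1,2), of 0] le_funD[OF assms(3), of 0] le_funD[OF assms(4), of 0]
  by linarith

end

theory Submission
  imports Defs
begin

text \<open>
  If all fuzzy \<open>h\<close>-ideals are idempotent, then
  \<open>\<kappa> \<and> \<mu> = (\<kappa> \<and> \<mu>) \<odot>\<^sub>h (\<kappa> \<and> \<mu>) \<le> \<kappa> \<odot>\<^sub>h \<mu>\<close>, and the reverse inequality always holds.
  Distributivity then follows because the product has residuals: the largest fuzzy subset \<open>\<rho>\<close>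
  with \<open>\<kappa>(a) \<and> \<rho>(b) \<le> \<sigma>(a b)\<close> is a fuzzy \<open>h\<close>-ideal, so if \<open>\<sigma>\<close> bounds \<open>\<kappa> \<and> \<mu>\<close> and \<open>\<kappa> \<and> \<nu>\<close>,
  then \<open>\<rho>\<close> lies above \<open>\<mu>\<close> and \<open>\<nu>\<close>, hence above their join.
\<close>

section \<open>Closure properties of fuzzy h-ideals\<close>

lemma fuzzy_h_idealI:
  assumes "\<And>x. 0 \<le> \<mu> x" "\<And>x. \<mu> x \<le> 1"
    and "\<And>a b. min (\<mu> a) (\<mu> b) \<le> \<mu> (a + b)"
    and "\<And>a b. \<mu> a \<le> \<mu> (a * b)" "\<And>a b. \<mu> b \<le> \<mu> (a * b)"
    and "\<And>a b x y. x + a + y = b + y \<Longrightarrow> min (\<mu> a) (\<mu> b) \<le> \<mu> x"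
  shows "fuzzy_h_ideal \<mu>"
  using assms unfolding fuzzy_h_ideal_def fuzzy_subset_def by auto

lemma fuzzy_h_idealD:
  assumes "fuzzy_h_ideal \<mu>"
  shows "0 \<le> \<mu> x" "\<mu> x \<le> 1" "min (\<mu> a) (\<mu> b) \<le> \<mu> (a + b)"
    "\<mu> a \<le> \<mu> (a * b)" "\<mu> b \<le> \<mu> (a * b)"
    "x + a + y = b + y \<Longrightarrow> min (\<mu> a) (\<mu> b) \<le> \<mu> x"
  using assms unfolding fuzzy_h_ideal_def fuzzy_subset_def by (auto, meson)

text \<open>In threshold form: the level set of points with value at least \<open>c\<close> is
  closed under addition. Bounds of this shape chain as introduction rules without unfolding
  minima.\<close>

lemma fuzzy_h_ideal_add:
  assumes "fuzzy_h_ideal \<mu>" "c \<le> \<mu> a" "c \<le> \<mu> b"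
  shows "c \<le> \<mu> (a + b)"
  using fuzzy_h_idealD(3)[OF assms(1), of a b] assms(2,3) by linarith

lemma fuzzy_h_ideal_h:
  assumes "fuzzy_h_ideal \<mu>" "x + a + y = b + y" "c \<le> \<mu> a" "c \<le> \<mu> b"
  shows "c \<le> \<mu> x"
  using fuzzy_h_idealD(6)[OF assms(1,2)] assms(3,4) by linarith

lemma fuzzy_h_ideal_sum:
  assumes "fuzzy_h_ideal \<mu>" "finite A" "A \<noteq> {}" "\<And>i. i \<in> A \<Longrightarrow> c \<le> \<mu> (f i)"
  shows "c \<le> \<mu> (sum f A)"
  using assms(2-4)
  by (induction A rule: finite_ne_induct) (auto intro: fuzzy_h_ideal_add[OF assms(1)])

lemma fuzzy_h_ideal_min:
  assumes \<mu>: "fuzzy_h_ideal \<mu>" and \<nu>: "fuzzy_h_ideal \<nu>"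
  shows "fuzzy_h_ideal (\<lambda>x. min (\<mu> x) (\<nu> x))"
proof (rule fuzzy_h_idealI)
  show "0 \<le> min (\<mu> x) (\<nu> x)" "min (\<mu> x) (\<nu> x) \<le> 1" for x
    using fuzzy_h_idealD(1,2)[OF \<mu>, of x] fuzzy_h_idealD(1)[OF \<nu>, of x] by auto
  show "min (min (\<mu> a) (\<nu> a)) (min (\<mu> b) (\<nu> b)) \<le> min (\<mu> (a + b)) (\<nu> (a + b))" for a b
    by (auto intro!: fuzzy_h_ideal_add[OF \<mu>] fuzzy_h_ideal_add[OF \<nu>])
  show "min (\<mu> a) (\<nu> a) \<le> min (\<mu> (a * b)) (\<nu> (a * b))" for a b
    using fuzzy_h_idealD(4)[OF \<mu>, of a b] fuzzy_h_idealD(4)[OF \<nu>, of a b] by linarith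
  show "min (\<mu> b) (\<nu> b) \<le> min (\<mu> (a * b)) (\<nu> (a * b))" for a b
    using fuzzy_h_idealD(5)[OF \<mu>, of b a] fuzzy_h_idealD(5)[OF \<nu>, of b a] by linarith
  show "min (min (\<mu> a) (\<nu> a)) (min (\<mu> b) (\<nu> b)) \<le> min (\<mu> x) (\<nu> x)" if "x + a + y = b + y" for a b x y
    using fuzzy_h_idealD(6)[OF \<mu> that] fuzzy_h_idealD(6)[OF \<nu> that] by linarith
qed

text \<open>Each closure condition bounds a value from below by other values, and such conditions
  survive pointwise infima. This later supplies joins for arbitrary pairs, including those whose
  h-sum is not an upper bound.\<close>

lemma fuzzy_h_ideal_Inf:
  fixes M :: "('a::semiring_0 \<Rightarrow> real) set"
  assumes M: "\<And>\<mu>. \<mu> \<in> M \<Longrightarrow> fuzzy_h_ideal \<mu>" and "M \<noteq> {}"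
  shows "fuzzy_h_ideal (\<lambda>x. INF \<mu>\<in>M. \<mu> x)"
proof -
  let ?I = "\<lambda>x. INF \<mu>\<in>M. \<mu> x"
  have bdd: "bdd_below ((\<lambda>\<mu>. \<mu> x) ` M)" for x
    by (rule bdd_belowI[of _ 0]) (auto intro: fuzzy_h_idealD(1)[OF M])
  have le: "?I x \<le> \<mu> x" if "\<mu> \<in> M" for \<mu> x
    using that bdd by (rule cINF_lower[rotated])
  have ge: "c \<le> ?I x" if "\<And>\<mu>. \<mu> \<in> M \<Longrightarrow> c \<le> \<mu> x" for c x
    using \<open>M \<noteq> {}\<close> that by (rule cINF_greatest)
  show ?thesis
  proof (rule fuzzy_h_idealI)
    show "0 \<le> ?I x" for x by (rule ge) (rule fuzzy_h_idealD(1)[OF M])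
    show "?I x \<le> 1" for x
    proof -
      from \<open>M \<noteq> {}\<close> obtain \<mu> where "\<mu> \<in> M" by blast
      then show ?thesis using le[of \<mu> x] fuzzy_h_idealD(2)[OF M, of \<mu> x] by linarith
    qed
    show "min (?I a) (?I b) \<le> ?I (a + b)" for a b
      by (rule ge) (rule fuzzy_h_ideal_add[OF M min.coboundedI1[OF le] min.coboundedI2[OF le]])
    show "?I a \<le> ?I (a * b)" for a b
      by (rule ge) (rule order_trans[OF le fuzzy_h_idealD(4)[OF M]])
    show "?I b \<le> ?I (a * b)" for a b
      by (rule ge) (rule order_trans[OF le fuzzy_h_idealD(5)[OF M]])
    show "min (?I a) (?I b) \<le> ?I x" if "x + a + y = b + y" for a b x y
      by (rule ge) (rule fuzzy_h_ideal_h[OF M that min.coboundedI1[OF le] min.coboundedI2[OF le]])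
  qed
qed

section \<open>The h-intrinsic product\<close>

text \<open>Bounding the product by a fuzzy h-ideal reduces to bounding single products: closure
  under sums handles both sides of an expression for \<open>x\<close>, and the h-condition passes
  the bound on to \<open>x\<close>.\<close>

lemma h_product_le:
  assumes \<sigma>: "fuzzy_h_ideal \<sigma>" and mult: "\<And>a b. min (\<mu> a) (\<nu> b) \<le> \<sigma> (a * b)"
  shows "(\<mu> \<odot>\<^sub>h \<nu>) x \<le> \<sigma> x"
proof (cases "h_product_values \<mu> \<nu> x = {}")
  case True
  \<comment> \<open>The product takes its default value 0 here, which lies below \<sigma> by
    nonnegativity.\<close>
  then show ?thesis by (simp add: h_product_def fuzzy_h_idealD(1)[OF \<sigma>])
next
  case False
  have sum: "(MIN i\<in>{1..m}. min (\<mu> (a i)) (\<nu> (b i))) \<le> \<sigma> (\<Sum>i = 1..m. a i * b i)"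
    if "1 \<le> m" for m :: nat and a b
  proof (rule fuzzy_h_ideal_sum[OF \<sigma>])
    show "(MIN i\<in>{1..m}. min (\<mu> (a i)) (\<nu> (b i))) \<le> \<sigma> (a i * b i)" if "i \<in> {1..m}" for i
      using that by (intro order_trans[OF _ mult] Min_le finite_imageI imageI) auto
  qed (use that in auto)
  have "v \<le> \<sigma> x" if "v \<in> h_product_values \<mu> \<nu> x" for v
  proof -
    from that obtain m n :: nat and a b a' b' z where mn: "1 \<le> m" "1 \<le> n"
      and eq: "x + (\<Sum>i = 1..m. a i * b i) + z = (\<Sum>j = 1..n. a' j * b' j) + z"
      and v: "v = min (MIN i\<in>{1..m}. min (\<mu> (a i)) (\<nu> (b i)))
          (MIN j\<in>{1..n}. min (\<mu> (a' j)) (\<nu> (b' j)))"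
      unfolding h_product_values_def by blast
    show ?thesis
      unfolding v
      by (rule fuzzy_h_ideal_h[OF \<sigma> eq])
        (rule min.coboundedI1[OF sum[OF mn(1)]], rule min.coboundedI2[OF sum[OF mn(2)]])
  qed
  with False show ?thesis by (auto simp: h_product_def intro: cSup_least)
qed

text \<open>The same expressions for \<open>x\<close> compete in both suprema, and each contributes
  at least as much on the right. The bound by 1 keeps the right-hand set bounded, so that its
  \<open>Sup\<close> is meaningful.\<close>

lemma h_product_mono:
  assumes "\<And>x. \<mu> x \<le> \<mu>' x" "\<And>x. \<nu> x \<le> \<nu>' x" "\<And>x. \<mu>' x \<le> 1"
  shows "(\<mu> \<odot>\<^sub>h \<nu>) x \<le> (\<mu>' \<odot>\<^sub>h \<nu>') x"
proof -
  have mono: "(MIN i\<in>{1..m}. min (\<mu> (a i)) (\<nu> (b i))) \<le> (MIN i\<in>{1..m}. min (\<mu>' (a i)) (\<nu>' (b i)))"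
    if "1 \<le> m" for m :: nat and a b
  proof (rule Min.boundedI)
    fix v assume "v \<in> (\<lambda>i. min (\<mu>' (a i)) (\<nu>' (b i))) ` {1..m}"
    then obtain i where i: "i \<in> {1..m}" and v: "v = min (\<mu>' (a i)) (\<nu>' (b i))" by blast
    have "(MIN i\<in>{1..m}. min (\<mu> (a i)) (\<nu> (b i))) \<le> min (\<mu> (a i)) (\<nu> (b i))"
      using i by (intro Min_le finite_imageI imageI) auto
    also have "\<dots> \<le> v" unfolding v by (intro min.mono assms)
    finally show "(MIN i\<in>{1..m}. min (\<mu> (a i)) (\<nu> (b i))) \<le> v" .
  qed (use that in auto)
  have le_one: "(MIN i\<in>{1..m}. min (\<mu>' (a i)) (\<nu>' (b i))) \<le> 1" if "1 \<le> m" for m :: nat and a b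
    using that assms(3)[of "a 1"] by (intro Min_le[THEN order_trans, of _ "min (\<mu>' (a 1)) (\<nu>' (b 1))"]) auto
  \<comment> \<open>Whether an expression for \<open>x\<close> exists depends only on the hemiring,
    so both products fall back to the default 0 together.\<close>
  have empty_iff: "h_product_values \<mu> \<nu> x = {} \<longleftrightarrow> h_product_values \<mu>' \<nu>' x = {}"
    unfolding h_product_values_def by blast
  have bdd: "bdd_above (h_product_values \<mu>' \<nu>' x)"
    unfolding h_product_values_def by (rule bdd_aboveI[of _ 1]) (blast intro: min.coboundedI1 le_one)
  have dominated: "\<exists>w\<in>h_product_values \<mu>' \<nu>' x. v \<le> w" if "v \<in> h_product_values \<mu> \<nu> x" for v
  proof -
    from that obtain m n :: nat and a b a' b' z where mn: "1 \<le> m" "1 \<le> n"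
      and eq: "x + (\<Sum>i = 1..m. a i * b i) + z = (\<Sum>j = 1..n. a' j * b' j) + z"
      and v: "v = min (MIN i\<in>{1..m}. min (\<mu> (a i)) (\<nu> (b i)))
          (MIN j\<in>{1..n}. min (\<mu> (a' j)) (\<nu> (b' j)))"
      unfolding h_product_values_def by blast
    have "min (MIN i\<in>{1..m}. min (\<mu>' (a i)) (\<nu>' (b i)))
        (MIN j\<in>{1..n}. min (\<mu>' (a' j)) (\<nu>' (b' j))) \<in> h_product_values \<mu>' \<nu>' x"
      unfolding h_product_values_def using mn eq by blast
    then show ?thesis unfolding v by (rule rev_bexI) (intro min.mono mono mn)
  qed
  show ?thesis
    using empty_iff by (auto simp: h_product_def intro!: cSup_mono bdd dominated)
qed

lemma h_product_le_min:
  assumes "fuzzy_h_ideal \<mu>" "fuzzy_h_ideal \<nu>"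
  shows "(\<mu> \<odot>\<^sub>h \<nu>) x \<le> min (\<mu> x) (\<nu> x)"
  by (rule h_product_le[OF fuzzy_h_ideal_min[OF assms]])
    (rule min.mono[OF fuzzy_h_idealD(4)[OF assms(1)] fuzzy_h_idealD(5)[OF assms(2)]])

lemma h_product_eq_min:
  fixes \<mu> \<nu> :: "'a::semiring_0 \<Rightarrow> real"
  assumes idem: "\<forall>\<mu> :: 'a \<Rightarrow> real. fuzzy_h_ideal \<mu> \<longrightarrow> h_idempotent \<mu>"
    and \<mu>: "fuzzy_h_ideal \<mu>" and \<nu>: "fuzzy_h_ideal \<nu>"
  shows "\<mu> \<odot>\<^sub>h \<nu> = (\<lambda>x. min (\<mu> x) (\<nu> x))"
proof (intro ext antisym h_product_le_min \<mu> \<nu>)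
  fix x
  let ?m = "\<lambda>x. min (\<mu> x) (\<nu> x)"
  have "?m x = (?m \<odot>\<^sub>h ?m) x"
    using idem fuzzy_h_ideal_min[OF \<mu> \<nu>] unfolding h_idempotent_def by metis
  also have "\<dots> \<le> (\<mu> \<odot>\<^sub>h \<nu>) x"
    by (rule h_product_mono) (auto simp: fuzzy_h_idealD(2)[OF \<mu>])
  finally show "?m x \<le> (\<mu> \<odot>\<^sub>h \<nu>) x" .
qed

section \<open>Residuals of fuzzy h-ideals\<close>

text \<open>The infimum of the Goedel implications from \<open>\<mu>(a)\<close> to \<open>\<sigma>(a y)\<close>.\<close>

definition residual :: "('a::semiring_0 \<Rightarrow> real) \<Rightarrow> ('a \<Rightarrow> real) \<Rightarrow> 'a \<Rightarrow> real" where
  "residual \<mu> \<sigma> y = (INF a. if \<mu> a \<le> \<sigma> (a * y) then 1 else \<sigma> (a * y))"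

text \<open>This is the adjunction between minimum and Goedel implication, taken over all
  \<open>a\<close> at once. It characterises the residual by its lower bounds, which is how its
  ideal properties are checked.\<close>

lemma le_residual_iff:
  assumes "fuzzy_h_ideal \<sigma>"
  shows "t \<le> residual \<mu> \<sigma> y \<longleftrightarrow> t \<le> 1 \<and> (\<forall>a. min (\<mu> a) t \<le> \<sigma> (a * y))"
proof -
  let ?f = "\<lambda>a. if \<mu> a \<le> \<sigma> (a * y) then 1 else \<sigma> (a * y)"
  have "bdd_below (range ?f)"
    using fuzzy_h_idealD(1)[OF assms] by (auto intro!: bdd_belowI[of _ 0])
  then have "t \<le> residual \<mu> \<sigma> y \<longleftrightarrow> (\<forall>a. t \<le> ?f a)"
    unfolding residual_def by (subst le_cINF_iff) auto
  also have "\<dots> \<longleftrightarrow> (\<forall>a. t \<le> 1 \<and> min (\<mu> a) t \<le> \<sigma> (a * y))"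
  proof (rule all_cong1)
    \<comment> \<open>If \<open>\<mu> a \<le> \<sigma> (a * y)\<close>, the minimum condition is
      automatic; otherwise it says \<open>t \<le> \<sigma> (a * y)\<close>, which already forces
      \<open>t \<le> 1\<close>.\<close>
    show "t \<le> ?f a \<longleftrightarrow> t \<le> 1 \<and> min (\<mu> a) t \<le> \<sigma> (a * y)" for a
    using fuzzy_h_idealD(2)[OF assms, of "a * y"] by auto
  qed
  finally show ?thesis by blast
qed

lemma residual_mult_le:
  assumes "fuzzy_h_ideal \<sigma>"
  shows "residual \<mu> \<sigma> y \<le> 1" "min (\<mu> a) (residual \<mu> \<sigma> y) \<le> \<sigma> (a * y)"
  using le_residual_iff[OF assms, of "residual \<mu> \<sigma> y"] by auto

text \<open>Left multiplication by a fixed \<open>a\<close> preserves sums and the equation of the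
  h-condition, so those properties come from \<sigma>. For \<open>y * r\<close>, regroup as
  \<open>(a * y) * r\<close> and use that \<sigma> is an ideal; for \<open>r * y\<close>, regroup as
  \<open>(a * r) * y\<close> and use \<open>\<mu> a \<le> \<mu> (a * r)\<close>.\<close>

lemma fuzzy_h_ideal_residual:
  assumes \<mu>: "fuzzy_h_ideal \<mu>" and \<sigma>: "fuzzy_h_ideal \<sigma>"
  shows "fuzzy_h_ideal (residual \<mu> \<sigma>)"
proof -
  let ?\<rho> = "residual \<mu> \<sigma>"
  note [simp] = residual_mult_le(1)[OF \<sigma>]
  have mult: "t \<le> \<sigma> (a * y)" if "t \<le> \<mu> a" "t \<le> ?\<rho> y" for t a y
    using residual_mult_le(2)[OF \<sigma>, of \<mu> a y] that by linarith
  have le: "t \<le> ?\<rho> y" if "t \<le> 1" "\<And>a. min (\<mu> a) t \<le> \<sigma> (a * y)" for t y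
    using le_residual_iff[OF \<sigma>] that by blast
  show ?thesis
  proof (rule fuzzy_h_idealI)
    show "0 \<le> ?\<rho> x" for x
      by (rule le) (auto intro: min.coboundedI2 fuzzy_h_idealD(1)[OF \<sigma>])
    show "?\<rho> x \<le> 1" for x by simp
    show "min (?\<rho> a) (?\<rho> b) \<le> ?\<rho> (a + b)" for a b
      by (rule le) (auto simp: distrib_left min.coboundedI1 intro!: fuzzy_h_ideal_add[OF \<sigma>] mult)
    show "?\<rho> y \<le> ?\<rho> (y * r)" for y r
    proof (rule le)
      show "min (\<mu> a) (?\<rho> y) \<le> \<sigma> (a * (y * r))" for a
        using residual_mult_le(2)[OF \<sigma>, of \<mu> a y] fuzzy_h_idealD(4)[OF \<sigma>, of "a * y" r]
        by (simp add: mult.assoc)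
    qed simp
    show "?\<rho> y \<le> ?\<rho> (r * y)" for y r
    proof (rule le)
      show "min (\<mu> a) (?\<rho> y) \<le> \<sigma> (a * (r * y))" for a
        using residual_mult_le(2)[OF \<sigma>, of \<mu> "a * r" y] fuzzy_h_idealD(4)[OF \<mu>, of a r]
        by (simp add: mult.assoc)
    qed simp
    show "min (?\<rho> p) (?\<rho> q) \<le> ?\<rho> x" if "x + p + z = q + z" for p q x z
    proof (rule le)
      fix a
      have "a * x + a * p + a * z = a * q + a * z" using that by (metis distrib_left)
      then show "min (\<mu> a) (min (?\<rho> p) (?\<rho> q)) \<le> \<sigma> (a * x)"
        by (rule fuzzy_h_ideal_h[OF \<sigma>]) (auto intro!: mult)
    qed (simp add: min.coboundedI1)
  qed
qed

section \<open>The h-sum\<close>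

text \<open>The supremum need not be attained, but every strict lower bound is exceeded by an actual
  expression. Combined with \<open>dense_le\<close>, this turns inequalities between h-sums into
  manipulations of witnesses.\<close>

lemma less_h_sum_iff:
  assumes \<mu>: "fuzzy_h_ideal \<mu>" and \<nu>: "fuzzy_h_ideal \<nu>"
  shows "t < (\<mu> +\<^sub>h \<nu>) x \<longleftrightarrow>
    (\<exists>a1 b1 a2 b2 z. x + (a1 + b1) + z = (a2 + b2) + z \<and>
      t < \<mu> a1 \<and> t < \<mu> a2 \<and> t < \<nu> b1 \<and> t < \<nu> b2)"
proof -
  let ?S = "{min (min (\<mu> a1) (\<mu> a2)) (min (\<nu> b1) (\<nu> b2)) | a1 b1 a2 b2 z.
            x + (a1 + b1) + z = (a2 + b2) + z}"
  have "x + (0 + 0) + 0 = (x + 0) + 0" by simp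
  then have nonempty: "?S \<noteq> {}" by blast
  have "bdd_above ?S"
    using fuzzy_h_idealD(2)[OF \<mu>] by (intro bdd_aboveI[of _ 1]) (auto simp: min_le_iff_disj)
  then have "t < (\<mu> +\<^sub>h \<nu>) x \<longleftrightarrow> (\<exists>v\<in>?S. t < v)"
    unfolding h_sum_def by (rule less_cSup_iff[OF nonempty])
  also have "\<dots> \<longleftrightarrow> (\<exists>a1 b1 a2 b2 z. x + (a1 + b1) + z = (a2 + b2) + z \<and>
      t < min (min (\<mu> a1) (\<mu> a2)) (min (\<nu> b1) (\<nu> b2)))"
    by blast
  finally show ?thesis by (simp only: min_less_iff_conj conj_assoc)
qed

lemma fuzzy_h_ideal_h_sum:
  assumes \<mu>: "fuzzy_h_ideal \<mu>" and \<nu>: "fuzzy_h_ideal \<nu>"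
  shows "fuzzy_h_ideal (\<mu> +\<^sub>h \<nu>)"
proof -
  note less_iff = less_h_sum_iff[OF \<mu> \<nu>]
  have add: "t < \<kappa> (a + b)" if "fuzzy_h_ideal \<kappa>" "t < \<kappa> a" "t < \<kappa> b"
    for \<kappa> :: "'a \<Rightarrow> real" and t a b
    using fuzzy_h_idealD(3)[OF that(1), of a b] that(2,3) by linarith
  have right: "t < \<kappa> (a * b)" if "fuzzy_h_ideal \<kappa>" "t < \<kappa> a"
    for \<kappa> :: "'a \<Rightarrow> real" and t a b
    using fuzzy_h_idealD(4)[OF that(1), of a b] that(2) by linarith
  have left: "t < \<kappa> (a * b)" if "fuzzy_h_ideal \<kappa>" "t < \<kappa> b"
    for \<kappa> :: "'a \<Rightarrow> real" and t a b
    using fuzzy_h_idealD(5)[OF that(1), of b a] that(2) by linarith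
  show ?thesis
  proof (rule fuzzy_h_idealI)
    show "0 \<le> (\<mu> +\<^sub>h \<nu>) x" for x
    proof (rule dense_le)
      fix t :: real assume "t < 0"
      \<comment> \<open>A negative threshold lies below every membership value, so any expression
        for \<open>x\<close> will do; the one with zeros always exists.\<close>
      then have "\<forall>x. t < \<mu> x \<and> t < \<nu> x"
        using less_le_trans[OF _ fuzzy_h_idealD(1)[OF \<mu>]] less_le_trans[OF _ fuzzy_h_idealD(1)[OF \<nu>]]
        by auto
      moreover have "x + (0 + 0) + 0 = (x + 0) + 0" by simp
      ultimately show "t \<le> (\<mu> +\<^sub>h \<nu>) x"
        by (intro less_imp_le less_iff[THEN iffD2]) blast
    qed
    show "(\<mu> +\<^sub>h \<nu>) x \<le> 1" for x
      using h_sum_le[OF \<mu> \<nu>, of x] fuzzy_h_idealD(2)[OF \<mu>, of 0] by linarith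
    show "min ((\<mu> +\<^sub>h \<nu>) x) ((\<mu> +\<^sub>h \<nu>) y) \<le> (\<mu> +\<^sub>h \<nu>) (x + y)" for x y
    proof (rule dense_le)
      fix t assume "t < min ((\<mu> +\<^sub>h \<nu>) x) ((\<mu> +\<^sub>h \<nu>) y)"
      then obtain a1 b1 a2 b2 z c1 d1 c2 d2 w where
        eqs: "x + (a1 + b1) + z = (a2 + b2) + z" "y + (c1 + d1) + w = (c2 + d2) + w"
        and t: "t < \<mu> a1" "t < \<mu> a2" "t < \<nu> b1" "t < \<nu> b2"
          "t < \<mu> c1" "t < \<mu> c2" "t < \<nu> d1" "t < \<nu> d2"
        unfolding min_less_iff_conj less_iff by blast
      \<comment> \<open>The two witnessing equations are added; their cancelled terms combine to
        \<open>z + w\<close>.\<close>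
      have "(x + y) + ((a1 + c1) + (b1 + d1)) + (z + w) = (x + (a1 + b1) + z) + (y + (c1 + d1) + w)"
        by (simp add: ac_simps)
      also have "\<dots> = ((a2 + c2) + (b2 + d2)) + (z + w)"
        unfolding eqs by (simp add: ac_simps)
      finally have "t < (\<mu> +\<^sub>h \<nu>) (x + y)"
        unfolding less_iff using t by (blast intro: add \<mu> \<nu>)
      then show "t \<le> (\<mu> +\<^sub>h \<nu>) (x + y)" by simp
    qed
    show "(\<mu> +\<^sub>h \<nu>) x \<le> (\<mu> +\<^sub>h \<nu>) (x * r)" for x r
    proof (rule dense_le)
      fix t assume "t < (\<mu> +\<^sub>h \<nu>) x"
      then obtain a1 b1 a2 b2 z where eq: "x + (a1 + b1) + z = (a2 + b2) + z"
        and t: "t < \<mu> a1" "t < \<mu> a2" "t < \<nu> b1" "t < \<nu> b2"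
        unfolding less_iff by blast
      have "x * r + (a1 * r + b1 * r) + z * r = (a2 * r + b2 * r) + z * r"
        using arg_cong[OF eq, of "\<lambda>u. u * r"] by (simp add: distrib_right)
      then have "t < (\<mu> +\<^sub>h \<nu>) (x * r)"
        unfolding less_iff
        using t by (blast intro: right \<mu> \<nu>)
      then show "t \<le> (\<mu> +\<^sub>h \<nu>) (x * r)" by simp
    qed
    show "(\<mu> +\<^sub>h \<nu>) x \<le> (\<mu> +\<^sub>h \<nu>) (r * x)" for x r
    proof (rule dense_le)
      fix t assume "t < (\<mu> +\<^sub>h \<nu>) x"
      then obtain a1 b1 a2 b2 z where eq: "x + (a1 + b1) + z = (a2 + b2) + z"
        and t: "t < \<mu> a1" "t < \<mu> a2" "t < \<nu> b1" "t < \<nu> b2"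
        unfolding less_iff by blast
      have "r * x + (r * a1 + r * b1) + r * z = (r * a2 + r * b2) + r * z"
        using arg_cong[OF eq, of "\<lambda>u. r * u"] by (simp add: distrib_left)
      then have "t < (\<mu> +\<^sub>h \<nu>) (r * x)"
        unfolding less_iff
        using t by (blast intro: left \<mu> \<nu>)
      then show "t \<le> (\<mu> +\<^sub>h \<nu>) (r * x)" by simp
    qed
    show "min ((\<mu> +\<^sub>h \<nu>) p) ((\<mu> +\<^sub>h \<nu>) q) \<le> (\<mu> +\<^sub>h \<nu>) x" if x: "x + p + y = q + y" for p q x y
    proof (rule dense_le)
      fix t assume "t < min ((\<mu> +\<^sub>h \<nu>) p) ((\<mu> +\<^sub>h \<nu>) q)"
      then obtain a1 b1 a2 b2 z c1 d1 c2 d2 w where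
        eqs: "p + (a1 + b1) + z = (a2 + b2) + z" "q + (c1 + d1) + w = (c2 + d2) + w"
        and t: "t < \<mu> a1" "t < \<mu> a2" "t < \<nu> b1" "t < \<nu> b2"
          "t < \<mu> c1" "t < \<mu> c2" "t < \<nu> d1" "t < \<nu> d2"
        unfolding min_less_iff_conj less_iff by blast
      \<comment> \<open>The aim is an expression for \<open>x\<close> free of \<open>p\<close> and
        \<open>q\<close>. Adding \<open>a2 + b2 + z\<close> to \<open>x\<close> brings in
        \<open>p\<close> through the first equation, the hypothesis trades \<open>x + p + y\<close>
        for \<open>q + y\<close>, and adding \<open>c1 + d1 + w\<close> removes \<open>q\<close>
        through the second.\<close>
      have "x + ((a2 + c1) + (b2 + d1)) + (y + z + w) = x + ((a2 + b2) + z) + (c1 + d1) + (y + w)"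
        by (simp add: ac_simps)
      also have "\<dots> = (x + p + y) + (a1 + b1) + z + (c1 + d1) + w"
        unfolding eqs(1)[symmetric] by (simp add: ac_simps)
      also have "\<dots> = (q + (c1 + d1) + w) + (a1 + b1) + z + y"
        unfolding x by (simp add: ac_simps)
      also have "\<dots> = ((c2 + a1) + (d2 + b1)) + (y + z + w)"
        unfolding eqs(2) by (simp add: ac_simps)
      finally have "t < (\<mu> +\<^sub>h \<nu>) x"
        unfolding less_iff using t by (blast intro: add \<mu> \<nu>)
      then show "t \<le> (\<mu> +\<^sub>h \<nu>) x" by simp
    qed
  qed
qed

text \<open>Write \<open>x\<close> as itself plus 0. The zeros also contribute the value of \<nu> at
  0, which must not fall below \<open>\<mu> x\<close>; equality at 0 ensures this, since a fuzzy
  h-ideal is largest at 0.\<close>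

lemma le_h_sum_left:
  assumes \<mu>: "fuzzy_h_ideal \<mu>" and \<nu>: "fuzzy_h_ideal \<nu>" and "\<mu> 0 = \<nu> 0"
  shows "\<mu> x \<le> (\<mu> +\<^sub>h \<nu>) x"
proof (rule dense_le)
  fix t assume "t < \<mu> x"
  with h_ideal_le_zero[OF \<mu>, of x] \<open>\<mu> 0 = \<nu> 0\<close> have "t < \<mu> 0" "t < \<nu> 0" by auto
  moreover have "x + (0 + 0) + 0 = (x + 0) + 0" by simp
  ultimately have "t < (\<mu> +\<^sub>h \<nu>) x"
    unfolding less_h_sum_iff[OF \<mu> \<nu>] using \<open>t < \<mu> x\<close> by blast
  then show "t \<le> (\<mu> +\<^sub>h \<nu>) x" by simp
qed

lemma le_h_sum_right:
  assumes \<mu>: "fuzzy_h_ideal \<mu>" and \<nu>: "fuzzy_h_ideal \<nu>" and "\<mu> 0 = \<nu> 0"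
  shows "\<nu> x \<le> (\<mu> +\<^sub>h \<nu>) x"
proof (rule dense_le)
  fix t assume "t < \<nu> x"
  with h_ideal_le_zero[OF \<nu>, of x] \<open>\<mu> 0 = \<nu> 0\<close> have "t < \<mu> 0" "t < \<nu> 0" by auto
  moreover have "x + (0 + 0) + 0 = (0 + x) + 0" by simp
  ultimately have "t < (\<mu> +\<^sub>h \<nu>) x"
    unfolding less_h_sum_iff[OF \<mu> \<nu>] using \<open>t < \<nu> x\<close> by blast
  then show "t \<le> (\<mu> +\<^sub>h \<nu>) x" by simp
qed

text \<open>At every level below the h-sum, all four components lie in the corresponding level set
  of \<sigma>, which is closed under addition and the h-condition.\<close>

lemma h_sum_least:
  assumes \<mu>: "fuzzy_h_ideal \<mu>" and \<nu>: "fuzzy_h_ideal \<nu>" and \<sigma>: "fuzzy_h_ideal \<sigma>"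
    and "\<mu> \<le> \<sigma>" "\<nu> \<le> \<sigma>"
  shows "(\<mu> +\<^sub>h \<nu>) x \<le> \<sigma> x"
proof (rule dense_le)
  fix t assume "t < (\<mu> +\<^sub>h \<nu>) x"
  then obtain a1 b1 a2 b2 z where eq: "x + (a1 + b1) + z = (a2 + b2) + z"
    and t: "t < \<mu> a1" "t < \<mu> a2" "t < \<nu> b1" "t < \<nu> b2"
    unfolding less_h_sum_iff[OF \<mu> \<nu>] by blast
  with \<open>\<mu> \<le> \<sigma>\<close> \<open>\<nu> \<le> \<sigma>\<close> have "t \<le> \<sigma> a1" "t \<le> \<sigma> a2" "t \<le> \<sigma> b1" "t \<le> \<sigma> b2"
    by (meson le_funD less_imp_le order_trans)+
  then show "t \<le> \<sigma> x"
    by (intro fuzzy_h_ideal_h[OF \<sigma> eq] fuzzy_h_ideal_add[OF \<sigma>])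
qed

section \<open>The lattice of fuzzy h-ideals\<close>

lemma fuzzy_h_ideals_simps [simp]:
  "carrier fuzzy_h_ideals = Collect fuzzy_h_ideal"
  "le fuzzy_h_ideals = (\<le>)"
  "eq fuzzy_h_ideals = (=)"
  by (simp_all add: fuzzy_h_ideals_def)

lemma partial_order_fuzzy_h_ideals: "partial_order fuzzy_h_ideals"
  by unfold_locales auto

lemma greatest_min:
  assumes "fuzzy_h_ideal \<mu>" "fuzzy_h_ideal \<nu>"
  shows "greatest fuzzy_h_ideals (\<lambda>x. min (\<mu> x) (\<nu> x)) (Lower fuzzy_h_ideals {\<mu>, \<nu>})"
  using assms fuzzy_h_ideal_min[OF assms]
  by (auto simp: greatest_def Lower_def le_fun_def)

text \<open>The join is the pointwise infimum of all upper bounds, a family that contains the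
  constant 1. The h-sum cannot serve here, since it is an upper bound only if the two ideals agree
  at 0.\<close>

lemma ex_least_upper_bound:
  fixes \<mu> \<nu> :: "'a::semiring_0 \<Rightarrow> real"
  assumes \<mu>: "fuzzy_h_ideal \<mu>" and \<nu>: "fuzzy_h_ideal \<nu>"
  shows "\<exists>\<sigma>. least fuzzy_h_ideals \<sigma> (Upper fuzzy_h_ideals {\<mu>, \<nu>})"
proof -
  define M where "M = {\<sigma>. fuzzy_h_ideal \<sigma> \<and> \<mu> \<le> \<sigma> \<and> \<nu> \<le> \<sigma>}"
  have Upper: "Upper fuzzy_h_ideals {\<mu>, \<nu>} = M"
    using \<mu> \<nu> by (auto simp: Upper_def M_def)
  have M: "fuzzy_h_ideal \<sigma>" if "\<sigma> \<in> M" for \<sigma> using that by (simp add: M_def)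
  have "fuzzy_h_ideal (\<lambda>x :: 'a. 1 :: real)" by (rule fuzzy_h_idealI) auto
  then have "(\<lambda>x. 1) \<in> M"
    by (auto simp: M_def le_fun_def fuzzy_h_idealD(2)[OF \<mu>] fuzzy_h_idealD(2)[OF \<nu>])
  then have ne: "M \<noteq> {}" by blast
  let ?I = "\<lambda>x. INF \<sigma>\<in>M. \<sigma> x"
  have "bdd_below ((\<lambda>\<sigma>. \<sigma> x) ` M)" for x
    by (rule bdd_belowI[of _ 0]) (auto intro: fuzzy_h_idealD(1)[OF M])
  then have lower: "?I \<le> \<sigma>" if "\<sigma> \<in> M" for \<sigma>
    using that by (intro le_funI cINF_lower)
  have "\<mu> \<le> ?I" "\<nu> \<le> ?I"
    by (rule le_funI, rule cINF_greatest[OF ne], simp add: M_def le_fun_def)+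
  with fuzzy_h_ideal_Inf[OF M ne] have "?I \<in> M" unfolding M_def by blast
  moreover have "M \<subseteq> carrier fuzzy_h_ideals" using M by auto
  ultimately have "least fuzzy_h_ideals ?I M"
    unfolding least_def using lower by simp
  then show ?thesis unfolding Upper by blast
qed

lemma lattice_fuzzy_h_ideals: "lattice (fuzzy_h_ideals :: ('a::semiring_0 \<Rightarrow> real) gorder)"
proof -
  interpret partial_order "fuzzy_h_ideals :: ('a \<Rightarrow> real) gorder"
    by (rule partial_order_fuzzy_h_ideals)
  show ?thesis
  proof unfold_locales
    fix \<mu> \<nu> :: "'a \<Rightarrow> real"
    assume "\<mu> \<in> carrier fuzzy_h_ideals" "\<nu> \<in> carrier fuzzy_h_ideals"
    then have ideals: "fuzzy_h_ideal \<mu>" "fuzzy_h_ideal \<nu>" by simp_all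
    show "\<exists>\<sigma>. least fuzzy_h_ideals \<sigma> (Upper fuzzy_h_ideals {\<mu>, \<nu>})"
      by (rule ex_least_upper_bound[OF ideals])
    show "\<exists>\<sigma>. greatest fuzzy_h_ideals \<sigma> (Lower fuzzy_h_ideals {\<mu>, \<nu>})"
      using greatest_min[OF ideals] by blast
  qed
qed

interpretation fuzzy_h_ideals: lattice fuzzy_h_ideals
  by (rule lattice_fuzzy_h_ideals)

lemma meet_fuzzy_h_ideals:
  assumes "fuzzy_h_ideal \<mu>" "fuzzy_h_ideal \<nu>"
  shows "\<mu> \<sqinter>\<^bsub>fuzzy_h_ideals\<^esub> \<nu> = (\<lambda>x. min (\<mu> x) (\<nu> x))"
  by (rule fuzzy_h_ideals.meetI)
    (use assms in \<open>auto intro: fuzzy_h_ideals.greatest_unique[OF _ greatest_min[OF assms]]\<close>)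

lemma join_fuzzy_h_ideals:
  assumes \<mu>: "fuzzy_h_ideal \<mu>" and \<nu>: "fuzzy_h_ideal \<nu>" and "\<mu> 0 = \<nu> 0"
  shows "\<mu> \<squnion>\<^bsub>fuzzy_h_ideals\<^esub> \<nu> = \<mu> +\<^sub>h \<nu>"
proof -
  have "least fuzzy_h_ideals (\<mu> +\<^sub>h \<nu>) (Upper fuzzy_h_ideals {\<mu>, \<nu>})"
  proof (rule least_UpperI)
    show "\<kappa> \<sqsubseteq>\<^bsub>fuzzy_h_ideals\<^esub> \<mu> +\<^sub>h \<nu>" if "\<kappa> \<in> {\<mu>, \<nu>}" for \<kappa>
      using that le_h_sum_left[OF assms] le_h_sum_right[OF assms] by (auto simp: le_fun_def)
    show "\<mu> +\<^sub>h \<nu> \<sqsubseteq>\<^bsub>fuzzy_h_ideals\<^esub> \<sigma>" if "\<sigma> \<in> Upper fuzzy_h_ideals {\<mu>, \<nu>}" for \<sigma>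
      using that \<mu> \<nu> h_sum_least[OF \<mu> \<nu>, of \<sigma>] by (auto simp: Upper_def le_fun_def)
  qed (use \<mu> \<nu> fuzzy_h_ideal_h_sum in auto)
  from fuzzy_h_ideals.least_unique[OF _ this] show ?thesis
    by (rule fuzzy_h_ideals.joinI) (use \<mu> \<nu> in auto)
qed

section \<open>Distributivity and the characterisation\<close>

lemma distributive_lattice_fuzzy_h_ideals:
  assumes idem: "\<forall>\<mu> :: 'a::semiring_0 \<Rightarrow> real. fuzzy_h_ideal \<mu> \<longrightarrow> h_idempotent \<mu>"
  shows "distributive_lattice (fuzzy_h_ideals :: ('a \<Rightarrow> real) gorder)"
  unfolding distributive_lattice_def
proof (intro conjI ballI lattice_fuzzy_h_ideals)
  let ?L = "fuzzy_h_ideals :: ('a \<Rightarrow> real) gorder"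
  fix \<kappa> \<mu> \<nu> :: "'a \<Rightarrow> real"
  assume "\<kappa> \<in> carrier ?L" "\<mu> \<in> carrier ?L" "\<nu> \<in> carrier ?L"
  then have ideals: "fuzzy_h_ideal \<kappa>" "fuzzy_h_ideal \<mu>" "fuzzy_h_ideal \<nu>" by simp_all
  define \<tau> where "\<tau> = \<mu> \<squnion>\<^bsub>?L\<^esub> \<nu>"
  define \<sigma> where "\<sigma> = (\<kappa> \<sqinter>\<^bsub>?L\<^esub> \<mu>) \<squnion>\<^bsub>?L\<^esub> (\<kappa> \<sqinter>\<^bsub>?L\<^esub> \<nu>)"
  have meets: "fuzzy_h_ideal (\<kappa> \<sqinter>\<^bsub>?L\<^esub> \<mu>)" "fuzzy_h_ideal (\<kappa> \<sqinter>\<^bsub>?L\<^esub> \<nu>)"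
    using ideals fuzzy_h_ideals.meet_closed by auto
  have \<tau>: "fuzzy_h_ideal \<tau>" "\<mu> \<le> \<tau>" "\<nu> \<le> \<tau>"
    using ideals fuzzy_h_ideals.join_closed[of \<mu> \<nu>] fuzzy_h_ideals.join_left[of \<mu> \<nu>]
      fuzzy_h_ideals.join_right[of \<mu> \<nu>] by (auto simp: \<tau>_def)
  have \<sigma>: "fuzzy_h_ideal \<sigma>" "\<kappa> \<sqinter>\<^bsub>?L\<^esub> \<mu> \<le> \<sigma>" "\<kappa> \<sqinter>\<^bsub>?L\<^esub> \<nu> \<le> \<sigma>"
    using meets fuzzy_h_ideals.join_closed[of "\<kappa> \<sqinter>\<^bsub>?L\<^esub> \<mu>" "\<kappa> \<sqinter>\<^bsub>?L\<^esub> \<nu>"]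
      fuzzy_h_ideals.join_left[of "\<kappa> \<sqinter>\<^bsub>?L\<^esub> \<mu>" "\<kappa> \<sqinter>\<^bsub>?L\<^esub> \<nu>"]
      fuzzy_h_ideals.join_right[of "\<kappa> \<sqinter>\<^bsub>?L\<^esub> \<mu>" "\<kappa> \<sqinter>\<^bsub>?L\<^esub> \<nu>"] by (auto simp: \<sigma>_def)
  \<comment> \<open>Both \<kappa> and \<xi> are ideals, so \<open>min (\<kappa> a) (\<xi> y)\<close>
    is at most the value of their meet at \<open>a * y\<close>, hence at most
    \<open>\<sigma> (a * y)\<close>.\<close>
  have le_residual: "\<xi> \<le> residual \<kappa> \<sigma>"
    if \<xi>: "fuzzy_h_ideal \<xi>" and le: "\<kappa> \<sqinter>\<^bsub>?L\<^esub> \<xi> \<le> \<sigma>" for \<xi>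
  proof (rule le_funI)
    fix y
    have "min (\<kappa> a) (\<xi> y) \<le> \<sigma> (a * y)" for a
      using le_funD[OF le, of "a * y"] fuzzy_h_idealD(4)[OF ideals(1), of a y]
        fuzzy_h_idealD(5)[OF \<xi>, of y a]
      unfolding meet_fuzzy_h_ideals[OF ideals(1) \<xi>] by linarith
    then show "\<xi> y \<le> residual \<kappa> \<sigma> y"
      using le_residual_iff[OF \<sigma>(1)] fuzzy_h_idealD(2)[OF \<xi>] by blast
  qed
  \<comment> \<open>The residual is an element of the lattice above \<mu> and \<nu>, so the least
    upper bound \<tau> lies below it.\<close>
  have "\<tau> \<le> residual \<kappa> \<sigma>"
    using fuzzy_h_ideals.join_le[where x = \<mu> and y = \<nu> and z = "residual \<kappa> \<sigma>"] ideals le_residual \<sigma>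
      fuzzy_h_ideal_residual[OF ideals(1) \<sigma>(1)] by (auto simp: \<tau>_def)
  then have "(\<kappa> \<odot>\<^sub>h \<tau>) x \<le> \<sigma> x" for x
    by (intro h_product_le[OF \<sigma>(1)] order_trans[OF min.mono[OF order_refl] residual_mult_le(2)[OF \<sigma>(1)]])
      (rule le_funD)
  \<comment> \<open>Idempotency enters here: it identifies the meet with the product, and the
    product was bounded through the residual.\<close>
  then have le: "\<kappa> \<sqinter>\<^bsub>?L\<^esub> \<tau> \<le> \<sigma>"
    unfolding meet_fuzzy_h_ideals[OF ideals(1) \<tau>(1)] h_product_eq_min[OF idem ideals(1) \<tau>(1), symmetric]
    by (rule le_funI)
  \<comment> \<open>The reverse inequality is monotonicity of the meet, as in any lattice.\<close>
  have "\<kappa> \<sqinter>\<^bsub>?L\<^esub> \<mu> \<le> \<kappa> \<sqinter>\<^bsub>?L\<^esub> \<tau>" "\<kappa> \<sqinter>\<^bsub>?L\<^esub> \<nu> \<le> \<kappa> \<sqinter>\<^bsub>?L\<^esub> \<tau>"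
    using \<tau> by (auto simp: meet_fuzzy_h_ideals ideals le_fun_def min.coboundedI2)
  then have "\<sigma> \<le> \<kappa> \<sqinter>\<^bsub>?L\<^esub> \<tau>"
    using fuzzy_h_ideals.join_le[where x = "\<kappa> \<sqinter>\<^bsub>?L\<^esub> \<mu>" and y = "\<kappa> \<sqinter>\<^bsub>?L\<^esub> \<nu>"
        and z = "\<kappa> \<sqinter>\<^bsub>?L\<^esub> \<tau>"] meets
      fuzzy_h_ideals.meet_closed[of \<kappa> \<tau>] ideals(1) \<tau>(1) by (auto simp: \<sigma>_def)
  with le show "\<kappa> \<sqinter>\<^bsub>?L\<^esub> (\<mu> \<squnion>\<^bsub>?L\<^esub> \<nu>) = (\<kappa> \<sqinter>\<^bsub>?L\<^esub> \<mu>) \<squnion>\<^bsub>?L\<^esub> (\<kappa> \<sqinter>\<^bsub>?L\<^esub> \<nu>)"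
    unfolding \<sigma>_def \<tau>_def by (rule antisym)
qed

text \<open>The join clause carries the premise \<open>\<mu> 0 = \<nu> 0\<close> because the h-sum
  of ideals that differ at 0 is not an upper bound of them; the abstract join still exists for such
  pairs, and distributivity covers it.\<close>

theorem theorem4p10:
  shows "(\<forall>\<mu> :: 'a::semiring_0 \<Rightarrow> real. fuzzy_h_ideal \<mu> \<longrightarrow> h_idempotent \<mu>) \<longleftrightarrow>
    (distributive_lattice (fuzzy_h_ideals :: ('a \<Rightarrow> real) gorder) \<and>
     (\<forall>\<mu> \<nu> :: 'a \<Rightarrow> real. fuzzy_h_ideal \<mu> \<and> fuzzy_h_ideal \<nu> \<longrightarrow>
        (\<mu> 0 = \<nu> 0 \<longrightarrow> \<mu> \<squnion>\<^bsub>fuzzy_h_ideals\<^esub> \<nu> = \<mu> +\<^sub>h \<nu>) \<and>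
        \<mu> \<sqinter>\<^bsub>fuzzy_h_ideals\<^esub> \<nu> = \<mu> \<odot>\<^sub>h \<nu> \<and>
        \<mu> \<odot>\<^sub>h \<nu> = (\<lambda>x. min (\<mu> x) (\<nu> x))))"
  (is "?idem \<longleftrightarrow> ?lattice")
proof
  assume idem: ?idem
  show ?lattice
    by (simp add: distributive_lattice_fuzzy_h_ideals[OF idem] join_fuzzy_h_ideals
        h_product_eq_min[OF idem] meet_fuzzy_h_ideals)
next
  assume ?lattice
  \<comment> \<open>On the diagonal the product equals the minimum of \<mu> with itself.\<close>
  then have "\<mu> \<odot>\<^sub>h \<mu> = \<mu>" if "fuzzy_h_ideal \<mu>" for \<mu> :: "'a \<Rightarrow> real"
    using that by auto
  then show ?idem by (simp add: h_idempotent_def)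
qed

end
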